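(* Let $\kappa$ be a regular cardinal and suppose that $\Box(\kappa)$ holds. Then there is a compact Hausdorff space $X$ and a Fréchet point $x\in X$ such that $t(x,X_\delta)=\kappa$.
   Context: Cardinals called regular are infinite. $\Box(\kappa)$ is the statement that there exists a sequence $\langle C_\alpha:\alpha<\kappa\rangle$ such that: $C_\alpha$ is club (closed and unbounded) in $\alpha$ for $\alpha$ limit; $C_{\alpha+1}=\{\alpha\}$; $C_\alpha\cap\beta=C_\beta$ for every $\beta$ which is a limit point of $C_\alpha$; and there is no club $C$ in $\kappa$ such that $C\cap\alpha=C_\alpha$ for every $\alpha<\kappa$ which is a limit point of $C$. For a topological space $X$, the $G_\delta$-modification $X_\delta$ is the space with the same underlying set as $X$ and with the $G_\delta$ subsets of $X$ as a base for its topology. Tightness: for a point $x$ of a space $Y$, $t(x,Y)$ is the minimum cardinal $\lambda$ such that for every $A\subseteq Y$ with $x\in\overline{A}$ there is $B\subseteq A$ with $|B|\le\lambda$ and $x\in\overline{B}$. A point $x\in X$ is Fréchet if for every $A\subseteq X$, $x\in\overline{A}$ if and only if there is a sequence $\{x_n:n<\omega\}\subseteq A$ converging to $x$. *)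

theory Defs
  imports "HOL-Analysis.Analysis"
begin

unbundle cardinal_syntax

text \<open>
  A cardinal is a relation \<open>r\<close> with \<^const>\<open>Card_order\<close>: its field is ordered by \<open>r\<close> in the
  least possible order type, so that the elements of \<^term>\<open>Field r\<close> play the role of the ordinals
  below the cardinal. The ordinal represented by \<open>a\<close>, as the set of the smaller ordinals, is
  \<^term>\<open>underS r a\<close>, and its successor is the \<open>b\<close> with \<^prop>\<open>underS r b = under r a\<close>.
\<close>

definition is_ord_succ :: "'a rel \<Rightarrow> 'a \<Rightarrow> 'a \<Rightarrow> bool" where
  "is_ord_succ r a b \<longleftrightarrow> a \<in> Field r \<and> b \<in> Field r \<and> underS r b = under r a"

text \<open>Zero is not a limit ordinal.\<close>

definition is_ord_limit :: "'a rel \<Rightarrow> 'a \<Rightarrow> bool" where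
  "is_ord_limit r a \<longleftrightarrow> a \<in> Field r \<and> underS r a \<noteq> {} \<and> (\<nexists>b. is_ord_succ r b a)"

definition ord_limit_point :: "'a rel \<Rightarrow> 'a set \<Rightarrow> 'a \<Rightarrow> bool" where
  "ord_limit_point r C b \<longleftrightarrow> b \<in> Field r \<and> underS r b \<noteq> {} \<and>
     (\<forall>c\<in>underS r b. \<exists>d\<in>C \<inter> underS r b. c \<in> underS r d)"

text \<open>
  Here \<open>S\<close> is the set of ordinals below the limit ordinal in question: \<^term>\<open>underS r a\<close> for the
  ordinal represented by \<open>a\<close>, and \<^term>\<open>Field r\<close> for the cardinal \<open>r\<close> itself.
\<close>

definition club_in :: "'a rel \<Rightarrow> 'a set \<Rightarrow> 'a set \<Rightarrow> bool" where
  "club_in r S C \<longleftrightarrow> C \<subseteq> S \<and>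
     (\<forall>a\<in>S. \<exists>c\<in>C. a \<in> underS r c) \<and>
     (\<forall>b\<in>S. ord_limit_point r C b \<longrightarrow> b \<in> C)"

definition square :: "'a rel \<Rightarrow> bool" where
  "square r \<longleftrightarrow> (\<exists>C :: 'a \<Rightarrow> 'a set.
     (\<forall>a. is_ord_limit r a \<longrightarrow> club_in r (underS r a) (C a)) \<and>
     (\<forall>a b. is_ord_succ r a b \<longrightarrow> C b = {a}) \<and>
     (\<forall>a\<in>Field r. \<forall>b. ord_limit_point r (C a) b \<longrightarrow> C a \<inter> underS r b = C b) \<and>
     \<not> (\<exists>D. club_in r (Field r) D \<and>
            (\<forall>a. ord_limit_point r D a \<longrightarrow> D \<inter> underS r a = C a)))"

definition Gdelta_modification :: "'b topology \<Rightarrow> 'b topology" where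
  "Gdelta_modification X = topology (arbitrary union_of gdelta_in X)"

lemma openin_Gdelta_modification:
  "openin (Gdelta_modification X) = arbitrary union_of gdelta_in X"
  unfolding Gdelta_modification_def
  by (intro topology_inverse' istopology_base gdelta_in_Int)

lemma topspace_Gdelta_modification [simp]:
  "topspace (Gdelta_modification X) = topspace X"
proof
  show "topspace (Gdelta_modification X) \<subseteq> topspace X"
    using openin_topspace[of "Gdelta_modification X"]
    by (auto simp: openin_Gdelta_modification union_of_def dest!: gdelta_in_subset)
  have "openin (Gdelta_modification X) (topspace X)"
    by (simp add: openin_Gdelta_modification arbitrary_union_of_inc)
  then show "topspace X \<subseteq> topspace (Gdelta_modification X)"
    by (rule openin_subset)
qed

definition tightness_at_le :: "'b topology \<Rightarrow> 'b \<Rightarrow> 'a rel \<Rightarrow> bool" where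
  "tightness_at_le Y x r \<longleftrightarrow>
     (\<forall>A \<subseteq> topspace Y. x \<in> Y closure_of A \<longrightarrow> (\<exists>B \<subseteq> A. |B| \<le>o r \<and> x \<in> Y closure_of B))"

text \<open>
  \<open>t(x,Y) = r\<close>. It suffices to compare \<open>r\<close> with cardinals \<open>r'\<close> on the same type, because every
  cardinal smaller than \<open>r\<close> is the cardinality of a subset of \<^term>\<open>Field r\<close>.
\<close>

definition tightness_at_eq :: "'b topology \<Rightarrow> 'b \<Rightarrow> 'a rel \<Rightarrow> bool" where
  "tightness_at_eq Y x r \<longleftrightarrow> Card_order r \<and> tightness_at_le Y x r \<and>
     (\<forall>r' :: 'a rel. Card_order r' \<and> tightness_at_le Y x r' \<longrightarrow> r \<le>o r')"

definition Frechet_point :: "'b topology \<Rightarrow> 'b \<Rightarrow> bool" where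
  "Frechet_point X x \<longleftrightarrow> x \<in> topspace X \<and>
     (\<forall>A \<subseteq> topspace X. x \<in> X closure_of A \<longleftrightarrow>
        (\<exists>\<sigma> :: nat \<Rightarrow> 'b. range \<sigma> \<subseteq> A \<and> limitin X \<sigma> x sequentially))"

text \<open>
  The existential statement about spaces needs a fixed type of points. For a cardinal on \<open>'a\<close> the type
  \<open>'a set set\<close>, with at least \<open>2^(2^r)\<close> elements, loses no generality. Suppose that \<open>X\<close>
  is a compact Hausdorff space of any size with a Frechet point \<open>x\<close> whose tightness in the
  \<open>G\<^sub>\<delta>\<close>-modification is the infinite cardinal \<open>r\<close>. For each cardinal below \<open>r\<close> take a set
  witnessing that the tightness is larger, and shrink it to size at most \<open>r\<close> with \<open>x\<close> still in its
  \<open>G\<^sub>\<delta>\<close>-closure. The closure in \<open>X\<close> of the union of these sets, together with \<open>x\<close>, is a subspace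
  with the same properties, and being Hausdorff of density at most \<open>r\<close> it has at most
  \<open>2^(2^r)\<close> points.
\<close>

end

theory Submission
  imports Defs
begin

text \<open>
  Walk along the square sequence and let \<open>lev n \<gamma>\<close> be the set of the \<open>\<alpha> < \<gamma>\<close> that are
  reached from \<open>\<gamma>\<close> in at most \<open>n\<close> steps. By coherence of the sequence, the levels of different
  \<open>\<gamma>\<close> agree up to a bounded shift of \<open>n\<close>. Send \<open>\<alpha>\<close> to the set of all the levels that
  contain it; the space is the closure of the image in the Cantor cube, and the point is the empty set.
  A countable set of levels lies below some \<open>\<gamma> < \<kappa>\<close>, so a \<open>G\<^sub>\<delta>\<close>-neighbourhood of the
  empty set contains all points in none of the \<open>lev n \<gamma>\<close>, for some \<open>\<gamma>\<close>; as these
  neighbourhoods decrease with \<open>\<gamma>\<close>, the tightness is \<open>\<kappa>\<close>. If the empty set is in the closure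
  of \<open>A\<close> and, for some \<open>\<gamma>\<close>, the levels of \<open>\<gamma>\<close> at which points of \<open>A\<close> appear are
  unbounded, then points \<open>p\<^sub>n\<close> of \<open>A\<close> that appear only after level \<open>n\<close> converge to the
  empty set. Otherwise the bound is a constant \<open>n\<close> for unboundedly many \<open>\<gamma>\<close>; reducing \<open>n\<close>
  step by step yields a thread through the square sequence.
\<close>

section \<open>The Cantor cube of all subsets of a type\<close>

text \<open>The product of copies of \<open>bool\<close>, carried over to subsets by characteristic
  functions, so that points are sets and the distinguished point can be \<open>{}\<close>.\<close>

definition cantor_cube :: "'i set topology" where
  "cantor_cube = pullback_topology UNIV (\<lambda>p i. i \<in> p)
     (product_topology (\<lambda>_. discrete_topology (UNIV :: bool set)) UNIV)"

lemma topspace_cantor_cube [simp]: "topspace cantor_cube = UNIV"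
  by (simp add: cantor_cube_def topspace_pullback_topology)

text \<open>Characteristic functions and \<open>Collect\<close> are inverse to each other;
  compactness (Tychonoff) and the Hausdorff property come across from the product.\<close>

lemma cantor_cube_homeomorphic:
  "(cantor_cube :: 'i set topology) homeomorphic_space
     product_topology (\<lambda>_ :: 'i. discrete_topology (UNIV :: bool set)) UNIV"
proof -
  let ?P = "product_topology (\<lambda>_ :: 'i. discrete_topology (UNIV :: bool set)) UNIV"
  let ?f = "\<lambda>p i :: 'i. i \<in> p"
  have "continuous_map cantor_cube ?P ?f"
    unfolding cantor_cube_def continuous_map_def openin_pullback_topology topspace_pullback_topology
    by auto
  moreover have "continuous_map ?P cantor_cube Collect"
    unfolding cantor_cube_def by (rule continuous_map_pullback') (simp_all add: comp_def)
  ultimately have "homeomorphic_maps cantor_cube ?P ?f Collect"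
    by (simp add: homeomorphic_maps_def)
  then show ?thesis
    by (rule homeomorphic_maps_imp_homeomorphic_space)
qed

lemma compact_space_cantor_cube: "compact_space cantor_cube"
  using homeomorphic_compact_space[OF cantor_cube_homeomorphic]
  by (simp add: compact_space_product_topology compact_space_discrete_topology)

lemma Hausdorff_space_cantor_cube: "Hausdorff_space cantor_cube"
  using homeomorphic_Hausdorff_space[OF cantor_cube_homeomorphic]
  by (simp add: Hausdorff_space_product_topology)

text \<open>A basic box constrains only finitely many coordinates, and agreement with
  \<open>p\<close> on those keeps a set in the box; conversely, fixing the values on
  \<open>\<Phi>\<close> is a box.\<close>

lemma openin_cantor_cube:
  "openin cantor_cube U \<longleftrightarrow> (\<forall>p\<in>U. \<exists>\<Phi>. finite \<Phi> \<and> (\<forall>q. q \<inter> \<Phi> = p \<inter> \<Phi> \<longrightarrow> q \<in> U))"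
    (is "?L \<longleftrightarrow> ?R")
proof
  assume ?L
  then obtain V where V: "openin (product_topology (\<lambda>_. discrete_topology (UNIV :: bool set)) UNIV) V"
    and U: "U = {p. (\<lambda>i. i \<in> p) \<in> V}"
    unfolding cantor_cube_def openin_pullback_topology by auto
  show ?R
  proof
    fix p assume "p \<in> U"
    then have "(\<lambda>i. i \<in> p) \<in> V"
      using U by simp
    then obtain W where W: "finite {i. W i \<noteq> (UNIV :: bool set)}" "(\<lambda>i. i \<in> p) \<in> Pi\<^sub>E UNIV W"
        "Pi\<^sub>E UNIV W \<subseteq> V"
      using V unfolding openin_product_topology_alt by (auto simp del: PiE_UNIV_domain)
    have "q \<in> U" if "q \<inter> {i. W i \<noteq> UNIV} = p \<inter> {i. W i \<noteq> UNIV}" for q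
    proof -
      have "(\<lambda>i. i \<in> q) \<in> Pi\<^sub>E UNIV W"
      proof (intro PiE_I)
        fix i
        have "(i \<in> p) \<in> W i"
          using W(2) by auto
        then show "(i \<in> q) \<in> W i"
        proof (cases "W i = UNIV")
          case False
          then have "i \<in> q \<longleftrightarrow> i \<in> p"
            using that by blast
          then show ?thesis
            using \<open>(i \<in> p) \<in> W i\<close> by simp
        qed simp
      qed simp
      then show ?thesis
        using W(3) U by blast
    qed
    then show "\<exists>\<Phi>. finite \<Phi> \<and> (\<forall>q. q \<inter> \<Phi> = p \<inter> \<Phi> \<longrightarrow> q \<in> U)"
      using W(1) by blast
  qed
next
  assume R: ?R
  have "openin (product_topology (\<lambda>_. discrete_topology (UNIV :: bool set)) UNIV) {f. Collect f \<in> U}"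
    unfolding openin_product_topology_alt
  proof
    fix f :: "'a \<Rightarrow> bool" assume "f \<in> {f. Collect f \<in> U}"
    then obtain \<Phi> where \<Phi>: "finite \<Phi>" "\<And>q. q \<inter> \<Phi> = Collect f \<inter> \<Phi> \<Longrightarrow> q \<in> U"
      using R by blast
    define W where "W = (\<lambda>i. if i \<in> \<Phi> then {f i} else UNIV)"
    have "finite {i. W i \<noteq> UNIV}"
      by (rule finite_subset[OF _ \<Phi>(1)]) (auto simp: W_def)
    moreover have "f \<in> Pi\<^sub>E UNIV W"
      by (auto simp: W_def)
    moreover have "Collect g \<in> U" if "g \<in> Pi\<^sub>E UNIV W" for g
    proof -
      have "g i = f i" if "i \<in> \<Phi>" for i
        using \<open>g \<in> Pi\<^sub>E UNIV W\<close> that by (auto simp: W_def PiE_iff dest!: spec[of _ i])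
      then show ?thesis
        by (intro \<Phi>(2)) auto
    qed
    ultimately show "\<exists>W. finite {i \<in> UNIV. W i \<noteq> topspace (discrete_topology UNIV)} \<and>
        (\<forall>i\<in>UNIV. openin (discrete_topology UNIV) (W i)) \<and>
        f \<in> Pi\<^sub>E UNIV W \<and> Pi\<^sub>E UNIV W \<subseteq> {f. Collect f \<in> U}"
      by (intro exI[of _ W]) auto
  qed
  then show ?L
    unfolding cantor_cube_def openin_pullback_topology
    by (intro exI conjI) auto
qed

lemma in_cantor_cube_closure_of:
  "p \<in> cantor_cube closure_of S \<longleftrightarrow> (\<forall>\<Phi>. finite \<Phi> \<longrightarrow> (\<exists>q\<in>S. q \<inter> \<Phi> = p \<inter> \<Phi>))"
proof
  assume p: "p \<in> cantor_cube closure_of S"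
  show "\<forall>\<Phi>. finite \<Phi> \<longrightarrow> (\<exists>q\<in>S. q \<inter> \<Phi> = p \<inter> \<Phi>)"
  proof (intro allI impI)
    fix \<Phi> :: "'a set" assume "finite \<Phi>"
    then have "openin cantor_cube {q. q \<inter> \<Phi> = p \<inter> \<Phi>}"
      unfolding openin_cantor_cube by auto
    then have "\<exists>q. q \<in> S \<and> q \<in> {q. q \<inter> \<Phi> = p \<inter> \<Phi>}"
      using p unfolding in_closure_of by (metis (mono_tags) mem_Collect_eq)
    then show "\<exists>q\<in>S. q \<inter> \<Phi> = p \<inter> \<Phi>"
      by blast
  qed
next
  assume "\<forall>\<Phi>. finite \<Phi> \<longrightarrow> (\<exists>q\<in>S. q \<inter> \<Phi> = p \<inter> \<Phi>)"
  then show "p \<in> cantor_cube closure_of S"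
    unfolding in_closure_of openin_cantor_cube by (auto; metis)
qed

section \<open>Walks along a square sequence\<close>

locale square_sequence =
  fixes \<kappa> :: "'a rel" and C :: "'a \<Rightarrow> 'a set"
  assumes Cinfinite: "Cinfinite \<kappa>"
    and regular: "regularCard \<kappa>"
    and club_limit: "is_ord_limit \<kappa> a \<Longrightarrow> club_in \<kappa> (underS \<kappa> a) (C a)"
    and succ_eq: "is_ord_succ \<kappa> a b \<Longrightarrow> C b = {a}"
    and coherent: "\<lbrakk>a \<in> Field \<kappa>; ord_limit_point \<kappa> (C a) b\<rbrakk> \<Longrightarrow> C a \<inter> underS \<kappa> b = C b"
    and no_thread: "\<lbrakk>club_in \<kappa> (Field \<kappa>) D;
      \<And>a. ord_limit_point \<kappa> D a \<Longrightarrow> D \<inter> underS \<kappa> a = C a\<rbrakk> \<Longrightarrow> False"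
begin

section \<open>Order theory of \<kappa>: well-foundedness and bounds\<close>

abbreviation below (infix "\<sqsubset>" 50) where "a \<sqsubset> b \<equiv> a \<in> underS \<kappa> b"

abbreviation below_eq (infix "\<sqsubseteq>" 50) where "a \<sqsubseteq> b \<equiv> a = b \<or> a \<sqsubset> b"

lemma wo_rel: "wo_rel \<kappa>"
  using Cinfinite by (simp add: wo_rel_def card_order_on_well_order_on)

lemma less_irrefl [simp]: "\<not> a \<sqsubset> a"
  by (simp add: underS_def)

lemma less_trans: "a \<sqsubset> b \<Longrightarrow> b \<sqsubset> c \<Longrightarrow> a \<sqsubset> c"
  using wo_rel.TRANS[OF wo_rel] wo_rel.ANTISYM[OF wo_rel]
  unfolding underS_def trans_def antisym_def by blast

lemma less_Field: "a \<sqsubset> b \<Longrightarrow> a \<in> Field \<kappa>" "a \<sqsubset> b \<Longrightarrow> b \<in> Field \<kappa>"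
  by (auto simp: underS_def Field_def)

lemma less_linear: "a \<in> Field \<kappa> \<Longrightarrow> b \<in> Field \<kappa> \<Longrightarrow> a \<sqsubset> b \<or> a = b \<or> b \<sqsubset> a"
  using wo_rel.TOTALS[OF wo_rel] unfolding underS_def by blast

lemma less_induct [case_names less]: "(\<And>x. (\<And>y. y \<sqsubset> x \<Longrightarrow> P y) \<Longrightarrow> P x) \<Longrightarrow> P x"
  using wo_rel.WF[OF wo_rel] unfolding underS_def by (induction x rule: wf_induct_rule) blast

lemma exists_least:
  assumes "x \<in> Q" "Q \<subseteq> Field \<kappa>"
  shows "\<exists>m\<in>Q. \<forall>y\<in>Q. m \<sqsubseteq> y"
  using assms(1)
proof (induction x rule: less_induct)
  case (less x)
  then show ?case
    using less_linear assms(2) by blast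
qed

lemma exists_greater: "a \<in> Field \<kappa> \<Longrightarrow> \<exists>b. a \<sqsubset> b"
  using infinite_Card_order_limit[of \<kappa> a] Cinfinite
  unfolding cinfinite_def underS_def by blast

lemma Field_nonempty: "Field \<kappa> \<noteq> {}"
  using Cinfinite unfolding cinfinite_def by auto

lemma exists_greater2:
  assumes "a \<in> Field \<kappa>" "b \<in> Field \<kappa>"
  shows "\<exists>c. a \<sqsubset> c \<and> b \<sqsubset> c"
  using assms by (metis exists_greater less_linear less_trans)

text \<open>By regularity a cofinal set has size \<kappa>, so a smaller set has no element above
  some \<open>a\<close>; anything beyond \<open>a\<close> is then a strict bound.\<close>

lemma small_bounded:
  assumes "S \<subseteq> Field \<kappa>" "|S| <o \<kappa>"
  shows "\<exists>b\<in>Field \<kappa>. \<forall>a\<in>S. a \<sqsubset> b"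
proof -
  have "\<not> cofinal S \<kappa>"
    using assms regular not_ordLess_ordIso unfolding regularCard_def by blast
  then obtain a where "a \<in> Field \<kappa>" and a: "\<And>b. b \<in> S \<Longrightarrow> \<not> a \<sqsubset> b"
    unfolding cofinal_def underS_def by blast
  moreover obtain b where "a \<sqsubset> b"
    using exists_greater \<open>a \<in> Field \<kappa>\<close> by blast
  ultimately show ?thesis
    using assms(1) less_linear less_trans less_Field by (metis subsetD)
qed

text \<open>On a countable cardinal no ordinal is a limit point, so that the whole field is a thread.\<close>

lemma natLeq_less: "natLeq <o \<kappa>"
proof (rule ccontr)
  assume "\<not> natLeq <o \<kappa>"
  then have le: "\<kappa> \<le>o natLeq"
    using wo_rel natLeq_Well_order by (simp add: wo_rel_def not_ordLess_iff_ordLeq)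
  have fin: "finite (underS \<kappa> a)" if "a \<in> Field \<kappa>" for a
    using card_of_underS[of \<kappa> a] that Cinfinite le ordLess_ordLeq_trans
    by (auto simp: finite_iff_ordLess_natLeq)
  have nolim: "\<not> ord_limit_point \<kappa> D a" for D a
  proof
    assume "ord_limit_point \<kappa> D a"
    then have "finite (underS \<kappa> a)" "underS \<kappa> a \<noteq> {}"
      and *: "\<And>c. c \<sqsubset> a \<Longrightarrow> \<exists>d. d \<sqsubset> a \<and> c \<sqsubset> d"
      using fin unfolding ord_limit_point_def by blast+
    \<comment> \<open>A finite strict order in which every element has a larger one is
      empty.\<close>
    moreover have "underS \<kappa> a = {}"
      using \<open>finite (underS \<kappa> a)\<close> less_irrefl less_trans
      by (rule finite_transitivity_chain[where R = "\<lambda>x y. x \<sqsubset> y"]) (use * in blast)+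
    ultimately show False
      by blast
  qed
  have "club_in \<kappa> (Field \<kappa>) (Field \<kappa>)"
    unfolding club_in_def using exists_greater less_Field by blast
  then show False
    using no_thread nolim by blast
qed

text \<open>Uncountability of \<kappa> brings countable sets within reach of regularity. The bound
  serves the iteration of length \<omega>, the G-delta neighbourhoods and the pigeonhole argument on
  level numbers.\<close>

lemma countable_bounded:
  assumes "S \<subseteq> Field \<kappa>" "countable S"
  shows "\<exists>b\<in>Field \<kappa>. \<forall>a\<in>S. a \<sqsubset> b"
proof (rule small_bounded)
  have "|S| \<le>o natLeq"
    using assms(2) card_of_nat card_of_ordLeq ordLeq_ordIso_trans
    unfolding countable_def by (metis subset_UNIV)
  then show "|S| <o \<kappa>"
    using natLeq_less ordLeq_ordLess_trans by blast
qed (fact assms)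

section \<open>First steps of walks, and the levels they define\<close>

lemma limit_or_succ: "a \<sqsubset> b \<Longrightarrow> is_ord_limit \<kappa> b \<or> (\<exists>c. is_ord_succ \<kappa> c b)"
  unfolding is_ord_limit_def using less_Field by blast

lemma le_of_succ:
  assumes "is_ord_succ \<kappa> c b"
  shows "a \<sqsubset> b \<longleftrightarrow> a \<sqsubseteq> c"
proof -
  have "underS \<kappa> b = under \<kappa> c" "c \<in> Field \<kappa>"
    using assms unfolding is_ord_succ_def by blast+
  moreover have "a \<in> under \<kappa> c \<longleftrightarrow> a \<sqsubseteq> c"
    using \<open>c \<in> Field \<kappa>\<close> wo_rel.REFL[OF wo_rel]
    by (auto simp: under_def underS_def refl_on_def)
  ultimately show ?thesis
    by blast
qed

text \<open>Unboundedness at limits; at a successor the sole element of \<open>C b\<close> is the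
  predecessor, which may be \<open>a\<close> itself, hence the non-strict inequality.\<close>

lemma C_cofinal:
  assumes "a \<sqsubset> b"
  shows "\<exists>c\<in>C b. a \<sqsubseteq> c \<and> c \<sqsubset> b"
  using limit_or_succ[OF assms]
proof (elim disjE exE)
  assume "is_ord_limit \<kappa> b"
  then show ?thesis
    using club_limit assms unfolding club_in_def by blast
next
  fix c assume "is_ord_succ \<kappa> c b"
  then show ?thesis
    using succ_eq le_of_succ assms by auto
qed

text \<open>The first step of the minimal walk from \<gamma> towards \<alpha>, usually written min
  (\<open>C \<gamma>\<close> - \<alpha>), given as a relation.\<close>

definition step :: "'a \<Rightarrow> 'a \<Rightarrow> 'a \<Rightarrow> bool" where
  "step \<alpha> \<gamma> s \<longleftrightarrow> s \<in> C \<gamma> \<and> s \<sqsubset> \<gamma> \<and> \<alpha> \<sqsubseteq> s \<and> (\<forall>d\<in>C \<gamma>. d \<sqsubset> s \<longrightarrow> d \<sqsubset> \<alpha>)"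

lemma step_exists:
  assumes "\<alpha> \<sqsubset> \<gamma>"
  shows "\<exists>s. step \<alpha> \<gamma> s"
proof -
  let ?Q = "{c \<in> C \<gamma>. \<alpha> \<sqsubseteq> c \<and> c \<sqsubset> \<gamma>}"
  have "?Q \<noteq> {}"
    using C_cofinal[OF assms] by blast
  moreover have "?Q \<subseteq> Field \<kappa>"
    by (auto dest: less_Field)
  ultimately obtain m where "m \<in> ?Q" "\<forall>y\<in>?Q. m \<sqsubseteq> y"
    using exists_least[of _ ?Q] by blast
  have "d \<sqsubset> \<alpha>" if "d \<in> C \<gamma>" "d \<sqsubset> m" for d
  proof (rule ccontr)
    assume "\<not> d \<sqsubset> \<alpha>"
    then have "\<alpha> \<sqsubseteq> d"
      using less_linear less_Field assms that by blast
    then have "m \<sqsubseteq> d"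
      using \<open>\<forall>y\<in>?Q. m \<sqsubseteq> y\<close> \<open>m \<in> ?Q\<close> that less_trans by blast
    then show False
      using that less_trans less_irrefl by blast
  qed
  then have "step \<alpha> \<gamma> m"
    using \<open>m \<in> ?Q\<close> unfolding step_def by blast
  then show ?thesis ..
qed

lemma step_unique:
  assumes "step \<alpha> \<gamma> s" "step \<alpha> \<gamma> t"
  shows "s = t"
  using assms unfolding step_def by (metis less_irrefl less_linear less_trans less_Field)

text \<open>In Todorcevic's notation, \<open>lev n \<gamma>\<close> is the set of the \<open>\<alpha> < \<gamma>\<close> with
  \<open>\<rho>\<^sub>2 \<alpha> \<gamma> \<le> n\<close>.\<close>

primrec lev :: "nat \<Rightarrow> 'a \<Rightarrow> 'a set" where
  "lev 0 \<gamma> = {}"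
| "lev (Suc n) \<gamma> = {\<alpha>. \<alpha> \<sqsubset> \<gamma> \<and> (\<exists>s. step \<alpha> \<gamma> s \<and> (\<alpha> = s \<or> \<alpha> \<in> lev n s))}"

lemma lev_less: "\<alpha> \<in> lev n \<gamma> \<Longrightarrow> \<alpha> \<sqsubset> \<gamma>"
  by (cases n) auto

lemma lev_Suc: "lev n \<gamma> \<subseteq> lev (Suc n) \<gamma>"
proof (induction n arbitrary: \<gamma>)
  case (Suc n)
  then show ?case
    unfolding lev.simps(2)[of "Suc n"] unfolding lev.simps(2)[of n \<gamma>] by blast
qed simp

lemma lev_mono: "m \<le> n \<Longrightarrow> lev m \<gamma> \<subseteq> lev n \<gamma>"
  using lev_Suc by (rule lift_Suc_mono_le)

text \<open>Each step goes strictly down, so by well-foundedness the walk arrives after finitely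
  many.\<close>

lemma lev_exists: "\<alpha> \<sqsubset> \<gamma> \<Longrightarrow> \<exists>n. \<alpha> \<in> lev n \<gamma>"
proof (induction \<gamma> rule: less_induct)
  case (less \<gamma>)
  obtain s where s: "step \<alpha> \<gamma> s"
    using step_exists less.prems by blast
  then consider "\<alpha> = s" | "\<alpha> \<sqsubset> s" "s \<sqsubset> \<gamma>"
    unfolding step_def by blast
  then show ?case
  proof cases
    case 1
    then have "\<alpha> \<in> lev (Suc 0) \<gamma>"
      using s less.prems by auto
    then show ?thesis ..
  next
    case 2
    then obtain n where "\<alpha> \<in> lev n s"
      using less.IH by blast
    then have "\<alpha> \<in> lev (Suc n) \<gamma>"
      using s less.prems by auto
    then show ?thesis ..
  qed
qed

text \<open>The first step is unique, so the walk from \<gamma> continues as the walk from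
  \<open>s\<close> and is longer by exactly one.\<close>

lemma lev_step:
  assumes "step \<alpha> \<gamma> s" "\<alpha> \<sqsubset> s"
  shows "\<alpha> \<in> lev (Suc n) \<gamma> \<longleftrightarrow> \<alpha> \<in> lev n s"
proof -
  have "\<alpha> \<sqsubset> \<gamma>"
    using assms less_trans unfolding step_def by blast
  moreover have "step \<alpha> \<gamma> t \<longleftrightarrow> t = s" for t
    using assms(1) step_unique by blast
  ultimately show ?thesis
    using assms(2) by auto
qed

text \<open>By coherence \<open>C \<delta>\<close> and \<open>C \<gamma>\<close> agree below
  \<gamma>, and the step from \<gamma> towards \<alpha> already lies there. The walks from \<delta>
  and from \<gamma> therefore take the same first step.\<close>

lemma lev_limit_point:
  assumes "\<gamma> \<sqsubset> \<delta>" "ord_limit_point \<kappa> (C \<delta>) \<gamma>"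
  shows "lev n \<delta> \<inter> underS \<kappa> \<gamma> = lev n \<gamma>"
proof (cases n)
  case (Suc k)
  have C: "C \<delta> \<inter> underS \<kappa> \<gamma> = C \<gamma>"
    using coherent assms less_Field by blast
  have step: "step \<alpha> \<delta> s" if "\<alpha> \<sqsubset> \<gamma>" "step \<alpha> \<gamma> s" for \<alpha> s
  proof -
    have "s \<in> C \<delta>" "s \<sqsubset> \<gamma>" "\<alpha> \<sqsubseteq> s" "\<And>d. d \<in> C \<delta> \<Longrightarrow> d \<sqsubset> \<gamma> \<Longrightarrow> d \<sqsubset> s \<Longrightarrow> d \<sqsubset> \<alpha>"
      using that C unfolding step_def by auto
    moreover have "d \<sqsubset> \<gamma>" if "d \<sqsubset> s" for d
      using that \<open>s \<sqsubset> \<gamma>\<close> by (rule less_trans)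
    ultimately show ?thesis
      using less_trans[OF _ assms(1)] unfolding step_def by simp
  qed
  have "\<alpha> \<in> lev (Suc k) \<delta> \<longleftrightarrow> \<alpha> \<in> lev (Suc k) \<gamma>" if "\<alpha> \<sqsubset> \<gamma>" for \<alpha>
  proof -
    obtain s where "step \<alpha> \<gamma> s" "step \<alpha> \<delta> s"
      using step_exists step \<open>\<alpha> \<sqsubset> \<gamma>\<close> by blast
    then have "step \<alpha> \<gamma> t \<longleftrightarrow> t = s" "step \<alpha> \<delta> t \<longleftrightarrow> t = s" for t
      using step_unique by blast+
    moreover have "\<alpha> \<sqsubset> \<delta>"
      using that assms(1) less_trans by blast
    ultimately show ?thesis
      using that by simp
  qed
  then show ?thesis
    using Suc lev_less by blast
qed (simp add: lev_less)

text \<open>Induction on \<gamma>, and inside it on \<delta>. If \<gamma> is not a limit point of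
  \<open>C \<delta>\<close>, some \<mu> below \<gamma> bounds the part of \<open>C \<delta>\<close>
  below \<gamma>: ordinals below \<mu> are compared through \<mu>, while those between \<mu> and
  \<gamma> share one first step \<open>s\<close> from \<delta> and are compared through
  \<open>s\<close>.\<close>

lemma lev_coherent:
  assumes "\<gamma> \<sqsubseteq> \<delta>"
  shows "\<exists>m. \<forall>n. lev n \<gamma> \<subseteq> lev (n + m) \<delta> \<and> lev n \<delta> \<inter> underS \<kappa> \<gamma> \<subseteq> lev (n + m) \<gamma>"
  using assms
proof (induction \<gamma> arbitrary: \<delta> rule: less_induct)
  case (less \<gamma>)
  note outer = less.IH
  show ?case
    using less.prems
  proof (induction \<delta> rule: less_induct)
    case (less \<delta>)
    \<comment> \<open>The \<mu> of the last case is a witness against \<gamma> being a limit point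
      of \<open>C \<delta>\<close>.\<close>
    consider "\<gamma> = \<delta>" | "\<gamma> \<sqsubset> \<delta>" "ord_limit_point \<kappa> (C \<delta>) \<gamma>" | "underS \<kappa> \<gamma> = {}"
      | \<mu> where "\<gamma> \<sqsubset> \<delta>" "\<mu> \<sqsubset> \<gamma>" "\<And>d. d \<in> C \<delta> \<Longrightarrow> d \<sqsubset> \<gamma> \<Longrightarrow> d \<sqsubseteq> \<mu>"
      using less.prems less_linear less_Field unfolding ord_limit_point_def by (metis IntI)
    then show ?case
    proof cases
      case 1
      then have "\<forall>n. lev n \<gamma> \<subseteq> lev (n + 0) \<delta> \<and> lev n \<delta> \<inter> underS \<kappa> \<gamma> \<subseteq> lev (n + 0) \<gamma>"
        by simp
      then show ?thesis ..
    next
      case 2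
      then have "\<forall>n. lev n \<gamma> \<subseteq> lev (n + 0) \<delta> \<and> lev n \<delta> \<inter> underS \<kappa> \<gamma> \<subseteq> lev (n + 0) \<gamma>"
        using lev_limit_point[OF 2] by auto
      then show ?thesis ..
    next
      case 3
      then have "lev n \<gamma> = {}" for n
        using lev_less by blast
      then show ?thesis
        using 3 by simp
    next
      case 4
      obtain s where s: "step \<gamma> \<delta> s"
        using step_exists 4(1) by blast
      then have "s \<sqsubset> \<delta>" "\<gamma> \<sqsubseteq> s"
        unfolding step_def by auto
      obtain m1 where "\<forall>n. lev n \<gamma> \<subseteq> lev (n + m1) s \<and> lev n s \<inter> underS \<kappa> \<gamma> \<subseteq> lev (n + m1) \<gamma>"
        using less.IH[OF \<open>s \<sqsubset> \<delta>\<close> \<open>\<gamma> \<sqsubseteq> s\<close>] by blast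
      then have m1: "\<And>n. lev n \<gamma> \<subseteq> lev (n + m1) s"
          "\<And>n. lev n s \<inter> underS \<kappa> \<gamma> \<subseteq> lev (n + m1) \<gamma>"
        by blast+
      obtain m2 where "\<forall>n. lev n \<mu> \<subseteq> lev (n + m2) \<gamma> \<and> lev n \<gamma> \<inter> underS \<kappa> \<mu> \<subseteq> lev (n + m2) \<mu>"
        using outer[of \<mu> \<gamma>] 4 by blast
      then have m2: "\<And>n. lev n \<mu> \<subseteq> lev (n + m2) \<gamma>"
          "\<And>n. lev n \<gamma> \<inter> underS \<kappa> \<mu> \<subseteq> lev (n + m2) \<mu>"
        by blast+
      have "\<mu> \<sqsubset> \<delta>"
        using 4 less_trans by blast
      obtain m3 where "\<forall>n. lev n \<mu> \<subseteq> lev (n + m3) \<delta> \<and> lev n \<delta> \<inter> underS \<kappa> \<mu> \<subseteq> lev (n + m3) \<mu>"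
        using outer[of \<mu> \<delta>] \<open>\<mu> \<sqsubset> \<gamma>\<close> \<open>\<mu> \<sqsubset> \<delta>\<close> by blast
      then have m3: "\<And>n. lev n \<mu> \<subseteq> lev (n + m3) \<delta>"
          "\<And>n. lev n \<delta> \<inter> underS \<kappa> \<mu> \<subseteq> lev (n + m3) \<mu>"
        by blast+
      obtain m4 m5 where m45: "\<mu> \<in> lev m4 \<gamma>" "\<mu> \<in> lev m5 \<delta>"
        using lev_exists \<open>\<mu> \<sqsubset> \<gamma>\<close> \<open>\<mu> \<sqsubset> \<delta>\<close> by meson
      \<comment> \<open>\<open>Suc m1\<close> pays for the step to \<open>s\<close> and the passage
        between \<open>s\<close> and \<gamma>, \<open>m2 + m3\<close> for the detour through \<mu>,
        and \<open>m4\<close>, \<open>m5\<close> for \<mu> itself, which no level of \<mu>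
        contains.\<close>
      define m where "m = Suc m1 + m2 + m3 + m4 + m5"
      \<comment> \<open>Since \<open>C \<delta>\<close> has nothing strictly between \<mu> and
        \<gamma>, the step towards \<gamma> is also the step towards \<alpha>.\<close>
      have far: "step \<alpha> \<delta> s" "\<alpha> \<sqsubset> s" if "\<mu> \<sqsubset> \<alpha>" "\<alpha> \<sqsubset> \<gamma>" for \<alpha>
      proof -
        show "\<alpha> \<sqsubset> s"
          using that \<open>\<gamma> \<sqsubseteq> s\<close> less_trans by blast
        have "d \<sqsubset> \<alpha>" if "d \<in> C \<delta>" "d \<sqsubset> s" for d
          using s that 4(3) \<open>\<mu> \<sqsubset> \<alpha>\<close> less_trans unfolding step_def by blast
        then show "step \<alpha> \<delta> s"
          using s \<open>\<alpha> \<sqsubset> s\<close> unfolding step_def by blast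
      qed
      have "\<alpha> \<in> lev (n + m) \<delta>" if a: "\<alpha> \<in> lev n \<gamma>" for \<alpha> n
      proof -
        have "\<alpha> \<sqsubset> \<gamma>"
          using a lev_less by blast
        then consider "\<alpha> \<sqsubset> \<mu>" | "\<alpha> = \<mu>" | "\<mu> \<sqsubset> \<alpha>"
          using less_linear 4 less_Field by metis
        then show ?thesis
        proof cases
          case 1
          then have "\<alpha> \<in> lev (n + m2 + m3) \<delta>"
            using m2 m3 a by blast
          then show ?thesis
            using lev_mono[of "n + m2 + m3" "n + m" \<delta>] by (auto simp: m_def)
        next
          case 2
          then show ?thesis
            using lev_mono[of m5 "n + m" \<delta>] m45 by (auto simp: m_def)
        next
          case 3
          then have "\<alpha> \<in> lev (Suc (n + m1)) \<delta>"
            using lev_step far \<open>\<alpha> \<sqsubset> \<gamma>\<close> m1 a by blast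
          then show ?thesis
            using lev_mono[of "Suc (n + m1)" "n + m" \<delta>] by (auto simp: m_def)
        qed
      qed
      moreover have "\<alpha> \<in> lev (n + m) \<gamma>" if a: "\<alpha> \<in> lev n \<delta>" "\<alpha> \<sqsubset> \<gamma>" for \<alpha> n
      proof -
        consider "\<alpha> \<sqsubset> \<mu>" | "\<alpha> = \<mu>" | "\<mu> \<sqsubset> \<alpha>"
          using less_linear 4 less_Field a(2) by metis
        then show ?thesis
        proof cases
          case 1
          then have "\<alpha> \<in> lev (n + m3 + m2) \<gamma>"
            using m2 m3 a by blast
          then show ?thesis
            using lev_mono[of "n + m3 + m2" "n + m" \<gamma>] by (auto simp: m_def)
        next
          case 2
          then show ?thesis
            using lev_mono[of m4 "n + m" \<gamma>] m45 by (auto simp: m_def)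
        next
          case 3
          \<comment> \<open>\<open>lev 0\<close> is empty, so there is a step to spend, and
            \<open>lev_step\<close> lowers the level to \<open>k\<close>.\<close>
          obtain k where "n = Suc k"
            using a by (cases n) auto
          then have "\<alpha> \<in> lev (k + m1) \<gamma>"
            using lev_step far 3 a m1 by blast
          then show ?thesis
            using lev_mono[of "k + m1" "n + m" \<gamma>] \<open>n = Suc k\<close> by (auto simp: m_def)
        qed
      qed
      ultimately show ?thesis
        by blast
    qed
  qed
qed

section \<open>Threads\<close>

lemma limit_pointD:
  assumes "ord_limit_point \<kappa> D b" "a \<sqsubset> b"
  obtains d where "d \<in> D" "a \<sqsubset> d" "d \<sqsubset> b"
  using assms unfolding ord_limit_point_def by fast

text \<open>The ordinals closed under \<open>\<xi> \<mapsto> \<eta>\<close> are limit points of all the later \<open>C \<gamma>\<close>,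
  \<open>\<gamma> \<in> D\<close>, so the square sequence coheres along them.\<close>

lemma no_uniform_jump:
  assumes D: "\<And>\<xi>. \<xi> \<in> Field \<kappa> \<Longrightarrow> \<exists>\<gamma>\<in>D. \<xi> \<sqsubset> \<gamma>"
    and jump: "\<And>\<xi>. \<xi> \<in> Field \<kappa> \<Longrightarrow>
      \<exists>\<eta>. \<xi> \<sqsubset> \<eta> \<and> (\<forall>\<gamma>\<in>D. \<eta> \<sqsubset> \<gamma> \<longrightarrow> (\<exists>d\<in>C \<gamma>. \<xi> \<sqsubseteq> d \<and> d \<sqsubset> \<eta>))"
  shows False
proof -
  obtain h where h: "\<And>\<xi>. \<xi> \<in> Field \<kappa> \<Longrightarrow> \<xi> \<sqsubset> h \<xi>"
    and hC: "\<And>\<xi> \<gamma>. \<xi> \<in> Field \<kappa> \<Longrightarrow> \<gamma> \<in> D \<Longrightarrow> h \<xi> \<sqsubset> \<gamma> \<Longrightarrow> \<exists>d\<in>C \<gamma>. \<xi> \<sqsubseteq> d \<and> d \<sqsubset> h \<xi>"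
    using jump by metis
  define E where "E = {\<epsilon> \<in> Field \<kappa>. \<forall>\<gamma>\<in>D. \<epsilon> \<sqsubset> \<gamma> \<longrightarrow> ord_limit_point \<kappa> (C \<gamma>) \<epsilon>}"
  \<comment> \<open>The least upper bound of the iterates of \<open>h\<close> from \<open>a\<close>
    belongs to \<open>E\<close>; it exists because the iterates are countably many.\<close>
  have E_unbounded: "\<exists>\<epsilon>\<in>E. a \<sqsubset> \<epsilon>" if a: "a \<in> Field \<kappa>" for a
  proof -
    define x where "x = rec_nat a (\<lambda>_. h)"
    have x0: "x 0 = a" and xS: "x (Suc n) = h (x n)" for n
      by (simp_all add: x_def)
    have xF: "x n \<in> Field \<kappa>" for n
      using a h by (induction n) (auto simp: x0 xS intro: less_Field(2))
    have x_less: "x n \<sqsubset> x (Suc n)" for n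
      using h xF xS by simp
    let ?U = "{b \<in> Field \<kappa>. \<forall>n. x n \<sqsubset> b}"
    have "\<exists>b\<in>Field \<kappa>. \<forall>c\<in>range x. c \<sqsubset> b"
      by (rule countable_bounded) (use xF in auto)
    then obtain b where "b \<in> ?U"
      by auto
    then obtain \<epsilon> where \<epsilon>: "\<epsilon> \<in> ?U" "\<forall>y\<in>?U. \<epsilon> \<sqsubseteq> y"
      using exists_least[of b ?U] by auto
    have "ord_limit_point \<kappa> (C \<gamma>) \<epsilon>" if "\<gamma> \<in> D" "\<epsilon> \<sqsubset> \<gamma>" for \<gamma>
      unfolding ord_limit_point_def
    proof (intro conjI ballI)
      show "\<epsilon> \<in> Field \<kappa>"
        using \<epsilon> by simp
      show "underS \<kappa> \<epsilon> \<noteq> {}"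
        using \<epsilon> by blast
      fix c assume "c \<sqsubset> \<epsilon>"
      \<comment> \<open>By minimality of \<epsilon>, \<open>c\<close> lies at or below some
        \<open>x n\<close>; the jump from \<open>x (Suc n)\<close> then puts an element of
        \<open>C \<gamma>\<close> above \<open>c\<close> and below \<epsilon>.\<close>
      have "\<not> (\<forall>n. x n \<sqsubset> c)"
      proof
        assume "\<forall>n. x n \<sqsubset> c"
        then have "\<epsilon> \<sqsubseteq> c"
          using \<epsilon>(2) less_Field(1)[OF \<open>c \<sqsubset> \<epsilon>\<close>] by simp
        then show False
          using \<open>c \<sqsubset> \<epsilon>\<close> less_trans[OF \<open>c \<sqsubset> \<epsilon>\<close>, of c] by auto
      qed
      then obtain n where "c \<sqsubseteq> x n"
        using less_linear[OF less_Field(1)[OF \<open>c \<sqsubset> \<epsilon>\<close>] xF] by blast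
      then have "c \<sqsubset> x (Suc n)"
        using x_less less_trans[of c "x n"] by blast
      have "x (Suc (Suc n)) \<sqsubset> \<epsilon>"
        using \<epsilon>(1) by blast
      then have "h (x (Suc n)) \<sqsubset> \<gamma>"
        using \<open>\<epsilon> \<sqsubset> \<gamma>\<close> less_trans unfolding xS by blast
      then obtain d where "d \<in> C \<gamma>" "x (Suc n) \<sqsubseteq> d" "d \<sqsubset> x (Suc (Suc n))"
        using hC[OF xF[of "Suc n"] \<open>\<gamma> \<in> D\<close>] unfolding xS by blast
      moreover have "c \<sqsubset> d"
        using \<open>c \<sqsubset> x (Suc n)\<close> \<open>x (Suc n) \<sqsubseteq> d\<close> less_trans by blast
      moreover have "d \<sqsubset> \<epsilon>"
        using \<open>d \<sqsubset> x (Suc (Suc n))\<close> \<open>x (Suc (Suc n)) \<sqsubset> \<epsilon>\<close> by (rule less_trans)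
      ultimately show "\<exists>d\<in>C \<gamma> \<inter> underS \<kappa> \<epsilon>. c \<sqsubset> d"
        by blast
    qed
    moreover have "a \<sqsubset> \<epsilon>"
      using \<epsilon>(1) x0 by (metis (mono_tags) mem_Collect_eq)
    ultimately show ?thesis
      using \<epsilon>(1) unfolding E_def by blast
  qed
  have C_E: "C \<gamma> \<inter> underS \<kappa> \<epsilon> = C \<epsilon>" if "\<epsilon> \<in> E" "\<gamma> \<in> D" "\<epsilon> \<sqsubset> \<gamma>" for \<epsilon> \<gamma>
    using that coherent less_Field(2) unfolding E_def by blast
  have later: "\<exists>\<gamma>\<in>D. \<epsilon> \<sqsubset> \<gamma> \<and> \<epsilon>' \<sqsubset> \<gamma>" if E: "\<epsilon> \<in> E" "\<epsilon>' \<in> E" for \<epsilon> \<epsilon>'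
  proof -
    obtain \<xi> where \<xi>: "\<epsilon> \<sqsubset> \<xi>" "\<epsilon>' \<sqsubset> \<xi>"
      using exists_greater2[of \<epsilon> \<epsilon>'] E unfolding E_def by blast
    then obtain \<gamma> where "\<gamma> \<in> D" "\<xi> \<sqsubset> \<gamma>"
      using D less_Field(2) by blast
    then show ?thesis
      using \<xi> less_trans by blast
  qed
  \<comment> \<open>The candidate thread. Any two of the sets \<open>C \<epsilon>\<close> are
    compatible, because both are initial segments of \<open>C \<gamma>\<close> for a common later
    \<gamma> in \<open>D\<close>.\<close>
  define T where "T = (\<Union>\<epsilon>\<in>E. C \<epsilon>)"
  have T_E: "T \<inter> underS \<kappa> \<epsilon> = C \<epsilon>" if "\<epsilon> \<in> E" for \<epsilon>
  proof (intro equalityI subsetI)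
    fix y assume y: "y \<in> T \<inter> underS \<kappa> \<epsilon>"
    then obtain \<epsilon>' where \<epsilon>': "\<epsilon>' \<in> E" "y \<in> C \<epsilon>'"
      unfolding T_def by blast
    obtain \<gamma> where \<gamma>: "\<gamma> \<in> D" "\<epsilon> \<sqsubset> \<gamma>" "\<epsilon>' \<sqsubset> \<gamma>"
      using later[OF \<open>\<epsilon> \<in> E\<close> \<open>\<epsilon>' \<in> E\<close>] by blast
    show "y \<in> C \<epsilon>"
      using y \<epsilon>' C_E[OF \<open>\<epsilon> \<in> E\<close> \<gamma>(1,2)] C_E[OF \<open>\<epsilon>' \<in> E\<close> \<gamma>(1,3)] by blast
  next
    fix y assume y: "y \<in> C \<epsilon>"
    obtain \<gamma> where "\<gamma> \<in> D" "\<epsilon> \<sqsubset> \<gamma>"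
      using later[OF \<open>\<epsilon> \<in> E\<close> \<open>\<epsilon> \<in> E\<close>] by blast
    then show "y \<in> T \<inter> underS \<kappa> \<epsilon>"
      using y C_E[OF \<open>\<epsilon> \<in> E\<close>] \<open>\<epsilon> \<in> E\<close> unfolding T_def by blast
  qed
  have lim_E: "ord_limit_point \<kappa> T \<epsilon>" if "\<epsilon> \<in> E" for \<epsilon>
  proof -
    obtain \<gamma> where "\<gamma> \<in> D" "\<epsilon> \<sqsubset> \<gamma>"
      using later[OF \<open>\<epsilon> \<in> E\<close> \<open>\<epsilon> \<in> E\<close>] by blast
    then have "ord_limit_point \<kappa> (C \<gamma>) \<epsilon>" "C \<gamma> \<inter> underS \<kappa> \<epsilon> = T \<inter> underS \<kappa> \<epsilon>"
      using \<open>\<epsilon> \<in> E\<close> C_E[OF \<open>\<epsilon> \<in> E\<close>] T_E[OF \<open>\<epsilon> \<in> E\<close>] unfolding E_def by blast+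
    then show ?thesis
      unfolding ord_limit_point_def by simp
  qed
  \<comment> \<open>Limit points of \<open>T\<close> will be caught by the closedness of
    \<open>C \<epsilon>\<close>, which \<open>club_limit\<close> provides at limit ordinals.\<close>
  have limit: "is_ord_limit \<kappa> \<epsilon>" if "\<epsilon> \<in> E" for \<epsilon>
    unfolding is_ord_limit_def
  proof (intro conjI notI)
    show "\<epsilon> \<in> Field \<kappa>" "underS \<kappa> \<epsilon> = {} \<Longrightarrow> False"
      using lim_E[OF \<open>\<epsilon> \<in> E\<close>] unfolding ord_limit_point_def by blast+
    assume "\<exists>b. is_ord_succ \<kappa> b \<epsilon>"
    then obtain b where b: "is_ord_succ \<kappa> b \<epsilon>" ..
    then have "b \<sqsubset> \<epsilon>"
      using le_of_succ by blast
    then obtain d where "b \<sqsubset> d" "d \<sqsubset> \<epsilon>"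
      by (rule limit_pointD[OF lim_E[OF \<open>\<epsilon> \<in> E\<close>]])
    then have "d \<sqsubseteq> b"
      using le_of_succ[OF b] by simp
    then have "b \<sqsubset> b"
      using \<open>b \<sqsubset> d\<close> less_trans[of b d b] by auto
    then show False
      by simp
  qed
  \<comment> \<open>Beyond a limit point of \<open>T\<close> there is some \<epsilon> in
    \<open>E\<close>, and below it \<open>T\<close> is just \<open>C \<epsilon>\<close>; closedness
    and coherence of \<open>T\<close> are read off there.\<close>
  have lim_T: "\<exists>\<epsilon>\<in>E. b \<sqsubset> \<epsilon> \<and> ord_limit_point \<kappa> (C \<epsilon>) b \<and> T \<inter> underS \<kappa> b = C \<epsilon> \<inter> underS \<kappa> b"
    if b: "ord_limit_point \<kappa> T b" for b
  proof -
    have "b \<in> Field \<kappa>"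
      using b unfolding ord_limit_point_def by blast
    then obtain \<epsilon> where \<epsilon>: "\<epsilon> \<in> E" "b \<sqsubset> \<epsilon>"
      using E_unbounded by blast
    have "T \<inter> underS \<kappa> b = C \<epsilon> \<inter> underS \<kappa> b"
      using T_E[OF \<epsilon>(1)] less_trans[OF _ \<epsilon>(2)] by blast
    moreover from this have "ord_limit_point \<kappa> (C \<epsilon>) b"
      using b unfolding ord_limit_point_def by simp
    ultimately show ?thesis
      using \<epsilon> by blast
  qed
  have "club_in \<kappa> (Field \<kappa>) T"
    unfolding club_in_def
  proof (intro conjI ballI impI)
    show "T \<subseteq> Field \<kappa>"
    proof
      fix y assume "y \<in> T"
      then obtain \<epsilon> where "\<epsilon> \<in> E" "y \<in> C \<epsilon>"
        unfolding T_def by blast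
      then show "y \<in> Field \<kappa>"
        using T_E[OF \<open>\<epsilon> \<in> E\<close>] less_Field(1) by blast
    qed
  next
    fix a assume "a \<in> Field \<kappa>"
    then obtain \<epsilon> where "\<epsilon> \<in> E" "a \<sqsubset> \<epsilon>"
      using E_unbounded by blast
    then obtain c where "c \<in> T" "a \<sqsubset> c"
      using limit_pointD[OF lim_E] by metis
    then show "\<exists>c\<in>T. a \<sqsubset> c" ..
  next
    fix b assume "ord_limit_point \<kappa> T b"
    then obtain \<epsilon> where \<epsilon>: "\<epsilon> \<in> E" "b \<sqsubset> \<epsilon>" "ord_limit_point \<kappa> (C \<epsilon>) b"
      using lim_T by blast
    then have "b \<in> C \<epsilon>"
      using club_limit[OF limit] unfolding club_in_def by blast
    then show "b \<in> T"
      using \<epsilon>(1) unfolding T_def by blast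
  qed
  moreover have "T \<inter> underS \<kappa> b = C b" if "ord_limit_point \<kappa> T b" for b
  proof -
    obtain \<epsilon> where \<epsilon>: "\<epsilon> \<in> E" "b \<sqsubset> \<epsilon>" "ord_limit_point \<kappa> (C \<epsilon>) b"
        "T \<inter> underS \<kappa> b = C \<epsilon> \<inter> underS \<kappa> b"
      using lim_T[OF \<open>ord_limit_point \<kappa> T b\<close>] by blast
    then show ?thesis
      using coherent[OF less_Field(2)[OF \<epsilon>(2)] \<epsilon>(3)] by simp
  qed
  ultimately show False
    by (rule no_thread)
qed

section \<open>The space\<close>

definition family :: "'a set set" where
  "family = {lev n \<gamma> |n \<gamma>. \<gamma> \<in> Field \<kappa>}"

text \<open>Coordinates outside \<open>family\<close> are false for every ordinal, so the cube can
  be indexed by the whole type \<open>'a set\<close>.\<close>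

definition trace :: "'a \<Rightarrow> 'a set set" where
  "trace \<alpha> = {F \<in> family. \<alpha> \<in> F}"

definition points :: "'a set set set" where
  "points = cantor_cube closure_of (trace ` Field \<kappa>)"

definition space :: "'a set set topology" where
  "space = subtopology cantor_cube points"

lemma topspace_space [simp]: "topspace space = points"
  by (simp add: space_def)

lemma compact_space_space: "compact_space space"
  unfolding space_def points_def
  using closedin_compact_space[OF compact_space_cantor_cube] compactin_subspace closedin_closure_of
  by blast

lemma Hausdorff_space_space: "Hausdorff_space space"
  unfolding space_def by (rule Hausdorff_space_subtopology[OF Hausdorff_space_cantor_cube])

section \<open>Points as finitely realised patterns of levels\<close>

lemma lev_in_family [intro]: "\<gamma> \<in> Field \<kappa> \<Longrightarrow> lev n \<gamma> \<in> family"
  unfolding family_def by blast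

lemma trace_in_points: "\<alpha> \<in> Field \<kappa> \<Longrightarrow> trace \<alpha> \<in> points"
  unfolding points_def in_cantor_cube_closure_of by blast

text \<open>A point of the closure may come from no ordinal, but on finitely many coordinates it
  always looks like one; thus finite Boolean relations between levels pass to points.\<close>

lemma points_pattern:
  assumes "p \<in> points" "finite \<Phi>"
  obtains \<alpha> where "\<alpha> \<in> Field \<kappa>" "\<And>F. F \<in> \<Phi> \<Longrightarrow> F \<in> p \<longleftrightarrow> F \<in> family \<and> \<alpha> \<in> F"
proof -
  obtain \<alpha> where "\<alpha> \<in> Field \<kappa>" "trace \<alpha> \<inter> \<Phi> = p \<inter> \<Phi>"
    using assms unfolding points_def in_cantor_cube_closure_of by blast
  then show thesis
    using that unfolding trace_def by blast
qed

lemma points_subset_family: "p \<in> points \<Longrightarrow> p \<subseteq> family"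
  by (metis finite.emptyI finite_insert insertI1 points_pattern subsetI)

text \<open>One ordinal realises the pattern on all four sets at once. The disjunction later
  separates a level of a first step \<open>s\<close> from a level of \<xi>.\<close>

lemma points_prime:
  assumes p: "p \<in> points" and "F \<in> p" "G \<in> p" "H \<in> family" "H' \<in> family"
    and sub: "F \<inter> G \<subseteq> H \<union> H'"
  shows "H \<in> p \<or> H' \<in> p"
proof -
  obtain \<alpha> where "\<And>I. I \<in> {F, G, H, H'} \<Longrightarrow> I \<in> p \<longleftrightarrow> I \<in> family \<and> \<alpha> \<in> I"
    using points_pattern[OF p, of "{F, G, H, H'}"] by blast
  then show ?thesis
    using assms by blast
qed

lemma points_inter:
  assumes "p \<in> points" "F \<in> p" "G \<in> p" "H \<in> family" "F \<inter> G \<subseteq> H"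
  shows "H \<in> p"
  using points_prime[OF assms(1-4,4)] assms(5) by simp

lemma points_superset:
  assumes "p \<in> points" "F \<in> p" "F \<subseteq> H" "H \<in> family"
  shows "H \<in> p"
  using points_inter[OF assms(1,2,2,4)] assms(3) by simp

lemma empty_notin_point: "p \<in> points \<Longrightarrow> {} \<notin> p"
  by (metis finite.emptyI finite_insert insertI1 points_pattern empty_iff)

lemma point_up:
  assumes "p \<in> points" "\<gamma> \<sqsubseteq> \<delta>" "\<delta> \<in> Field \<kappa>" "lev n \<gamma> \<in> p"
  shows "\<exists>k. lev k \<delta> \<in> p"
proof -
  obtain m where "lev n \<gamma> \<subseteq> lev (n + m) \<delta>"
    using lev_coherent[OF assms(2)] by blast
  then have "lev (n + m) \<delta> \<in> p"
    using points_superset assms by (metis lev_in_family)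
  then show ?thesis ..
qed

lemma point_mono:
  assumes "p \<in> points" "m \<le> n" "lev m \<gamma> \<in> p" "\<gamma> \<in> Field \<kappa>"
  shows "lev n \<gamma> \<in> p"
  using points_superset[OF assms(1,3) lev_mono[OF assms(2)]] assms(4) by blast

text \<open>If \<gamma> is the smaller ordinal, \<open>lev k \<gamma>\<close> cuts
  \<open>lev n \<delta>\<close> down to ordinals below \<gamma>, as \<open>lev_coherent\<close>
  requires. Since \<open>m\<close> does not depend on \<open>p\<close>, it serves a whole sequence
  of points.\<close>

lemma point_coherent:
  assumes "\<gamma> \<in> Field \<kappa>" "\<delta> \<in> Field \<kappa>"
  shows "\<exists>m. \<forall>p\<in>points. \<forall>n k. lev n \<delta> \<in> p \<longrightarrow> lev k \<gamma> \<in> p \<longrightarrow> lev (n + m) \<gamma> \<in> p"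
proof -
  have "\<exists>m. \<forall>n k. lev n \<delta> \<inter> lev k \<gamma> \<subseteq> lev (n + m) \<gamma>"
  proof (cases "\<gamma> \<sqsubseteq> \<delta>")
    case True
    then obtain m where m: "\<And>n. lev n \<delta> \<inter> underS \<kappa> \<gamma> \<subseteq> lev (n + m) \<gamma>"
      using lev_coherent[of \<gamma> \<delta>] by blast
    have "lev n \<delta> \<inter> lev k \<gamma> \<subseteq> lev (n + m) \<gamma>" for n k
      using m[of n] lev_less by blast
    then show ?thesis
      by blast
  next
    case False
    then have "\<delta> \<sqsubseteq> \<gamma>"
      using less_linear assms by blast
    then obtain m where m: "\<And>n. lev n \<delta> \<subseteq> lev (n + m) \<gamma>"
      using lev_coherent[of \<delta> \<gamma>] by blast
    then show ?thesis
      by blast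
  qed
  then obtain m where m: "\<And>n k. lev n \<delta> \<inter> lev k \<gamma> \<subseteq> lev (n + m) \<gamma>"
    by blast
  have "lev (n + m) \<gamma> \<in> p" if "p \<in> points" "lev n \<delta> \<in> p" "lev k \<gamma> \<in> p" for p n k
    by (rule points_inter[OF that lev_in_family[OF assms(1)] m])
  then show ?thesis
    by blast
qed

text \<open>The sets \<open>far \<gamma>\<close> form a decreasing neighbourhood base of the empty set in the
  \<open>G\<^sub>\<delta>\<close>-modification.\<close>

definition far :: "'a \<Rightarrow> 'a set set set" where
  "far \<gamma> = {p \<in> points. \<forall>n. lev n \<gamma> \<notin> p}"

lemma far_antimono: "\<gamma> \<sqsubseteq> \<delta> \<Longrightarrow> \<delta> \<in> Field \<kappa> \<Longrightarrow> far \<delta> \<subseteq> far \<gamma>"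
  unfolding far_def using point_up by blast

lemma trace_in_far:
  assumes "\<alpha> \<in> Field \<kappa>"
  shows "trace \<alpha> \<in> far \<alpha>"
proof -
  have "\<alpha> \<notin> lev n \<alpha>" for n
    using lev_less less_irrefl by blast
  then show ?thesis
    using trace_in_points[OF assms] by (simp add: far_def trace_def)
qed

lemma trace_notin_far: "\<alpha> \<sqsubset> \<gamma> \<Longrightarrow> trace \<alpha> \<notin> far \<gamma>"
  unfolding far_def trace_def using lev_exists less_Field(2) by blast

text \<open>Each relevant coordinate is a level of some \<delta>; \<gamma> is taken above these
  countably many \<delta>. By \<open>point_up\<close>, a point containing such a level also contains
  a level of \<gamma>.\<close>

lemma far_avoids_countable:
  assumes "countable \<Phi>"
  shows "\<exists>\<gamma>\<in>Field \<kappa>. \<forall>p\<in>far \<gamma>. p \<inter> \<Phi> = {}"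
proof -
  have "\<forall>F\<in>family. \<exists>\<delta>. \<delta> \<in> Field \<kappa> \<and> (\<exists>n. F = lev n \<delta>)"
    unfolding family_def by blast
  then obtain f where f: "\<And>F. F \<in> family \<Longrightarrow> f F \<in> Field \<kappa> \<and> (\<exists>n. F = lev n (f F))"
    by metis
  obtain \<gamma> where \<gamma>: "\<gamma> \<in> Field \<kappa>" "\<And>F. F \<in> family \<inter> \<Phi> \<Longrightarrow> f F \<sqsubset> \<gamma>"
  proof -
    have "f ` (family \<inter> \<Phi>) \<subseteq> Field \<kappa>" "countable (f ` (family \<inter> \<Phi>))"
      using f assms by auto
    from countable_bounded[OF this] show thesis
      using that by blast
  qed
  have "p \<inter> \<Phi> = {}" if p: "p \<in> far \<gamma>" for p
  proof (rule ccontr)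
    assume "p \<inter> \<Phi> \<noteq> {}"
    then obtain F where F: "F \<in> p" "F \<in> \<Phi>"
      by blast
    have "p \<in> points"
      using p unfolding far_def by blast
    then have "F \<in> family"
      using F points_subset_family by blast
    then obtain n where "lev n (f F) \<in> p"
      using f F by metis
    moreover have "f F \<sqsubset> \<gamma>"
      using \<gamma>(2) F \<open>F \<in> family\<close> by blast
    ultimately have "\<exists>k. lev k \<gamma> \<in> p"
      using point_up[OF \<open>p \<in> points\<close>] \<gamma>(1) by blast
    then show False
      using p unfolding far_def by blast
  qed
  then show ?thesis
    using \<gamma>(1) by blast
qed

lemma empty_in_points: "{} \<in> points"
  unfolding points_def in_cantor_cube_closure_of
proof (intro allI impI)
  fix \<Phi> :: "'a set set" assume "finite \<Phi>"
  then obtain \<gamma> where "\<gamma> \<in> Field \<kappa>" "\<forall>p\<in>far \<gamma>. p \<inter> \<Phi> = {}"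
    using far_avoids_countable[of \<Phi>] countable_finite by blast
  then show "\<exists>q\<in>trace ` Field \<kappa>. q \<inter> \<Phi> = {} \<inter> \<Phi>"
    using trace_in_far by blast
qed

lemma empty_in_far: "{} \<in> far \<gamma>"
  unfolding far_def using empty_in_points by blast

lemma not_far:
  assumes "p \<in> points" "p \<noteq> {}"
  shows "\<exists>\<gamma>\<in>Field \<kappa>. p \<notin> far \<gamma>"
proof -
  obtain F where "F \<in> p" "F \<in> family"
    using assms points_subset_family by blast
  then show ?thesis
    unfolding family_def far_def by blast
qed

section \<open>Neighbourhoods of the empty set in the space\<close>

lemma empty_nhd:
  assumes "openin space U" "{} \<in> U"
  shows "\<exists>\<Phi>. finite \<Phi> \<and> (\<forall>q\<in>points. q \<inter> \<Phi> = {} \<longrightarrow> q \<in> U)"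
proof -
  obtain V where V: "openin cantor_cube V" "U = V \<inter> points"
    using assms(1) unfolding space_def openin_subtopology by blast
  then obtain \<Phi> where "finite \<Phi>" "\<And>q. q \<inter> \<Phi> = {} \<inter> \<Phi> \<Longrightarrow> q \<in> V"
    using assms(2) unfolding openin_cantor_cube by blast
  then show ?thesis
    using V(2) by auto
qed

lemma openin_avoid: "openin space {p \<in> points. F \<notin> p}"
proof -
  have "openin cantor_cube {p. F \<notin> p}"
    unfolding openin_cantor_cube
  proof
    fix p assume "p \<in> {p. F \<notin> p}"
    then show "\<exists>\<Phi>. finite \<Phi> \<and> (\<forall>q. q \<inter> \<Phi> = p \<inter> \<Phi> \<longrightarrow> q \<in> {p. F \<notin> p})"
      by (intro exI[of _ "{F}"]) auto
  qed
  then show ?thesis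
    unfolding space_def openin_subtopology by blast
qed

section \<open>Tightness\<close>

lemma openin_far: "openin (Gdelta_modification space) (far \<gamma>)"
proof -
  have "far \<gamma> = (\<Inter>n. {p \<in> points. lev n \<gamma> \<notin> p})"
    unfolding far_def by blast
  also have "gdelta_in space \<dots>"
    by (rule gdelta_in_Inter) (auto intro: open_imp_gdelta_in openin_avoid)
  finally show ?thesis
    unfolding openin_Gdelta_modification by (rule arbitrary_union_of_inc)
qed

text \<open>A G-delta set around \<open>{}\<close> is cut out by countably many open sets, and to
  lie in one of these it suffices to avoid finitely many coordinates.\<close>

lemma far_subset_Gdelta:
  assumes "openin (Gdelta_modification space) U" "{} \<in> U"
  shows "\<exists>\<gamma>\<in>Field \<kappa>. far \<gamma> \<subseteq> U"
proof -
  obtain G where G: "gdelta_in space G" "{} \<in> G" "G \<subseteq> U"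
    using assms unfolding openin_Gdelta_modification union_of_def by blast
  obtain \<U> where \<U>: "countable \<U>" "\<And>V. V \<in> \<U> \<Longrightarrow> openin space V" "\<Inter>\<U> = G"
    using G(1) unfolding gdelta_in_alt intersection_of_def by blast
  have "\<forall>V\<in>\<U>. \<exists>\<Phi>. finite \<Phi> \<and> (\<forall>q\<in>points. q \<inter> \<Phi> = {} \<longrightarrow> q \<in> V)"
    using empty_nhd \<U> G(2) by blast
  then obtain \<Phi> where \<Phi>: "\<And>V. V \<in> \<U> \<Longrightarrow> finite (\<Phi> V)"
      "\<And>V q. V \<in> \<U> \<Longrightarrow> q \<in> points \<Longrightarrow> q \<inter> \<Phi> V = {} \<Longrightarrow> q \<in> V"
    by metis
  have "countable (\<Union>V\<in>\<U>. \<Phi> V)"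
    using \<U>(1) \<Phi>(1) countable_finite by blast
  then obtain \<gamma> where \<gamma>: "\<gamma> \<in> Field \<kappa>" "\<forall>p\<in>far \<gamma>. p \<inter> (\<Union>V\<in>\<U>. \<Phi> V) = {}"
    using far_avoids_countable by blast
  have "p \<in> G" if p: "p \<in> far \<gamma>" for p
  proof -
    have "p \<in> points"
      using p unfolding far_def by blast
    moreover have "p \<inter> \<Phi> V = {}" if "V \<in> \<U>" for V
      using \<gamma>(2) p that by blast
    ultimately show ?thesis
      using \<Phi>(2) \<U>(3) by blast
  qed
  then show ?thesis
    using \<gamma>(1) G(3) by blast
qed

lemma empty_in_Gdelta_closure:
  "{} \<in> Gdelta_modification space closure_of A \<longleftrightarrow> (\<forall>\<gamma>\<in>Field \<kappa>. A \<inter> far \<gamma> \<noteq> {})"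
proof
  assume cl: "{} \<in> Gdelta_modification space closure_of A"
  show "\<forall>\<gamma>\<in>Field \<kappa>. A \<inter> far \<gamma> \<noteq> {}"
  proof
    fix \<gamma>
    have "\<exists>y. y \<in> A \<and> y \<in> far \<gamma>"
      using cl openin_far[of \<gamma>] empty_in_far[of \<gamma>] unfolding in_closure_of by simp
    then show "A \<inter> far \<gamma> \<noteq> {}"
      by blast
  qed
next
  assume A: "\<forall>\<gamma>\<in>Field \<kappa>. A \<inter> far \<gamma> \<noteq> {}"
  show "{} \<in> Gdelta_modification space closure_of A"
    unfolding in_closure_of
  proof (intro conjI allI impI)
    fix U assume "{} \<in> U \<and> openin (Gdelta_modification space) U"
    then obtain \<gamma> where "\<gamma> \<in> Field \<kappa>" "far \<gamma> \<subseteq> U"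
      using far_subset_Gdelta by blast
    then show "\<exists>y. y \<in> A \<and> y \<in> U"
      using A by blast
  qed (simp add: empty_in_points)
qed

text \<open>One point in each \<open>far \<gamma>\<close> suffices for the closure, which takes at
  most \<kappa> points. All traces together accumulate at \<open>{}\<close>, but fewer than \<kappa>
  of them come from a bounded set of ordinals and miss some \<open>far \<gamma>\<close>.\<close>

lemma tightness_at_eq_space: "tightness_at_eq (Gdelta_modification space) {} \<kappa>"
  unfolding tightness_at_eq_def
proof (intro conjI allI impI)
  show card: "Card_order \<kappa>"
    using Cinfinite by blast
  show "tightness_at_le (Gdelta_modification space) {} \<kappa>"
    unfolding tightness_at_le_def
  proof (intro allI impI)
    fix A assume "{} \<in> Gdelta_modification space closure_of A"
    then have "\<forall>\<gamma>\<in>Field \<kappa>. \<exists>p. p \<in> A \<inter> far \<gamma>"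
      unfolding empty_in_Gdelta_closure by blast
    then obtain f where f: "\<And>\<gamma>. \<gamma> \<in> Field \<kappa> \<Longrightarrow> f \<gamma> \<in> A \<inter> far \<gamma>"
      by metis
    have "|f ` Field \<kappa>| \<le>o \<kappa>"
      using card_of_image card_of_Field_ordIso[OF card] ordLeq_ordIso_trans by blast
    moreover have "{} \<in> Gdelta_modification space closure_of (f ` Field \<kappa>)"
      unfolding empty_in_Gdelta_closure using f by blast
    ultimately show "\<exists>B\<subseteq>A. |B| \<le>o \<kappa> \<and> {} \<in> Gdelta_modification space closure_of B"
      using f by (intro exI[of _ "f ` Field \<kappa>"]) blast
  qed
  fix r :: "'a rel"
  assume r: "Card_order r \<and> tightness_at_le (Gdelta_modification space) {} r"
  show "\<kappa> \<le>o r"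
  proof (rule ccontr)
    assume "\<not> \<kappa> \<le>o r"
    then have "r <o \<kappa>"
      using card r by (simp add: card_order_on_well_order_on not_ordLeq_iff_ordLess)
    have "{} \<in> Gdelta_modification space closure_of (trace ` Field \<kappa>)"
      unfolding empty_in_Gdelta_closure using trace_in_far by blast
    moreover have "trace ` Field \<kappa> \<subseteq> topspace (Gdelta_modification space)"
      using trace_in_points by auto
    ultimately obtain B where B: "B \<subseteq> trace ` Field \<kappa>" "|B| \<le>o r"
        "{} \<in> Gdelta_modification space closure_of B"
      using r unfolding tightness_at_le_def by blast
    \<comment> \<open>One ordinal is kept for each element of \<open>B\<close>, so that
      \<open>S\<close> is no larger than \<open>B\<close>.\<close>
    obtain S where S: "S \<subseteq> Field \<kappa>" "inj_on trace S" "B = trace ` S"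
      using B(1) by (metis subset_image_inj)
    then have "|S| \<le>o |B|"
      using card_of_ordLeq by blast
    then have "|S| <o \<kappa>"
      using B(2) \<open>r <o \<kappa>\<close> ordLeq_transitive ordLeq_ordLess_trans by blast
    then obtain \<gamma> where "\<gamma> \<in> Field \<kappa>" "\<forall>\<alpha>\<in>S. \<alpha> \<sqsubset> \<gamma>"
      using small_bounded S(1) by blast
    then show False
      using B(3) S(3) trace_notin_far unfolding empty_in_Gdelta_closure by blast
  qed
qed

section \<open>The Frechet property\<close>

text \<open>If the first steps over a fixed \<open>\<xi>\<close> from elements of \<open>D\<close> are unbounded, they replace
  \<open>D\<close> at the cost of one level; otherwise every \<open>\<xi>\<close> has a bound, against
  \<open>no_uniform_jump\<close>.\<close>

lemma no_uniform_level:
  assumes "B \<subseteq> points" "{} \<notin> B"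
    and "\<And>\<xi>. \<xi> \<in> Field \<kappa> \<Longrightarrow> B \<inter> far \<xi> \<noteq> {}"
    and "\<And>\<xi>. \<xi> \<in> Field \<kappa> \<Longrightarrow> \<exists>\<gamma>\<in>D. \<xi> \<sqsubset> \<gamma>"
    and "\<And>p \<gamma>. p \<in> B \<Longrightarrow> \<gamma> \<in> D \<Longrightarrow> p \<notin> far \<gamma> \<Longrightarrow> lev n \<gamma> \<in> p"
  shows False
  using assms
proof (induction n arbitrary: B D)
  \<comment> \<open>At level zero the bound would put the empty set \<open>lev 0 \<delta>\<close>
    into a point.\<close>
  case 0
  obtain p where p: "p \<in> B"
    using 0(3) Field_nonempty by blast
  then have pp: "p \<in> points" "p \<noteq> {}"
    using 0(1,2) by blast+
  then obtain \<gamma> where \<gamma>: "\<gamma> \<in> Field \<kappa>" "p \<notin> far \<gamma>"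
    using not_far by blast
  then obtain \<delta> where \<delta>: "\<delta> \<in> D" "\<gamma> \<sqsubset> \<delta>"
    using 0(4) by blast
  then have "p \<notin> far \<delta>"
    using far_antimono[of \<gamma> \<delta>] less_Field(2)[OF \<delta>(2)] \<gamma>(2) by blast
  then have "lev 0 \<delta> \<in> p"
    using 0(5) p \<delta>(1) by blast
  then show ?case
    using empty_notin_point[OF pp(1)] by simp
next
  case (Suc n)
  note B = Suc.prems(1,2,3) and D = Suc.prems(4) and bound = Suc.prems(5)
  show ?case
  proof (cases "\<exists>\<xi>\<in>Field \<kappa>. \<forall>\<eta>. \<xi> \<sqsubset> \<eta> \<longrightarrow> (\<exists>\<gamma>\<in>D. \<eta> \<sqsubset> \<gamma> \<and> (\<forall>d\<in>C \<gamma>. \<xi> \<sqsubseteq> d \<longrightarrow> \<not> d \<sqsubset> \<eta>))")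
    case True
    then obtain \<xi> where \<xi>: "\<xi> \<in> Field \<kappa>"
      and gap: "\<And>\<eta>. \<xi> \<sqsubset> \<eta> \<Longrightarrow> \<exists>\<gamma>\<in>D. \<eta> \<sqsubset> \<gamma> \<and> (\<forall>d\<in>C \<gamma>. \<xi> \<sqsubseteq> d \<longrightarrow> \<not> d \<sqsubset> \<eta>)"
      by blast
    define D' where "D' = {s. \<exists>\<gamma>\<in>D. step \<xi> \<gamma> s \<and> \<xi> \<sqsubset> s}"
    show False
    \<comment> \<open>Passing to \<open>far \<xi>\<close> discards the points that contain a level
      of \<xi>; this rules out the second alternative of \<open>points_prime\<close> at the
      end.\<close>
    proof (rule Suc.IH[of "B \<inter> far \<xi>" D'])
      show "B \<inter> far \<xi> \<subseteq> points" "{} \<notin> B \<inter> far \<xi>"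
        using B(1,2) by blast+
    next
      fix \<beta> assume \<beta>: "\<beta> \<in> Field \<kappa>"
      obtain \<zeta> where \<zeta>: "\<xi> \<sqsubset> \<zeta>" "\<beta> \<sqsubset> \<zeta>"
        using exists_greater2[OF \<xi> \<beta>] by blast
      have "\<zeta> \<in> Field \<kappa>"
        using less_Field(2)[OF \<zeta>(1)] .
      then have "far \<zeta> \<subseteq> far \<xi> \<inter> far \<beta>" "B \<inter> far \<zeta> \<noteq> {}"
        using far_antimono \<zeta> B(3) by blast+
      then show "B \<inter> far \<xi> \<inter> far \<beta> \<noteq> {}"
        by blast
      obtain \<eta> where \<eta>: "\<zeta> \<sqsubset> \<eta>"
        using exists_greater[OF \<open>\<zeta> \<in> Field \<kappa>\<close>] by blast
      have "\<xi> \<sqsubset> \<eta>"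
        using \<zeta>(1) \<eta> by (rule less_trans)
      \<comment> \<open>The gap forces the first step from \<gamma> towards \<xi> to land at \<eta>
        or later, hence beyond \<beta>.\<close>
      then obtain \<gamma> where \<gamma>: "\<gamma> \<in> D" "\<eta> \<sqsubset> \<gamma>" "\<forall>d\<in>C \<gamma>. \<xi> \<sqsubseteq> d \<longrightarrow> \<not> d \<sqsubset> \<eta>"
        using gap by blast
      have "\<xi> \<sqsubset> \<gamma>"
        using \<open>\<xi> \<sqsubset> \<eta>\<close> \<gamma>(2) by (rule less_trans)
      then obtain s where s: "step \<xi> \<gamma> s"
        using step_exists by blast
      then have "\<not> s \<sqsubset> \<eta>" "s \<in> Field \<kappa>"
        using \<gamma>(3) less_Field(1) unfolding step_def by blast+
      then have "\<eta> \<sqsubseteq> s"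
        using less_linear[of s \<eta>] less_Field(2)[OF \<eta>] by blast
      then have "\<zeta> \<sqsubset> s"
        using less_trans[OF \<eta>] \<eta> by blast
      then have "\<xi> \<sqsubset> s" "\<beta> \<sqsubset> s"
        using less_trans[OF \<zeta>(1)] less_trans[OF \<zeta>(2)] by blast+
      then show "\<exists>s\<in>D'. \<beta> \<sqsubset> s"
        using \<gamma>(1) s unfolding D'_def by blast
    next
      fix p s assume p: "p \<in> B \<inter> far \<xi>" and "s \<in> D'" and "p \<notin> far s"
      then obtain \<gamma> where \<gamma>: "\<gamma> \<in> D" "step \<xi> \<gamma> s" "\<xi> \<sqsubset> s"
        unfolding D'_def by blast
      have pp: "p \<in> points"
        using p B(1) by blast
      have "s \<sqsubset> \<gamma>"
        using \<gamma>(2) unfolding step_def by blast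
      have \<gamma>F: "\<gamma> \<in> Field \<kappa>" and sF: "s \<in> Field \<kappa>"
        using less_Field[OF \<open>s \<sqsubset> \<gamma>\<close>] by blast+
      have "p \<notin> far \<gamma>"
        using far_antimono[of s \<gamma>] \<open>s \<sqsubset> \<gamma>\<close> \<gamma>F \<open>p \<notin> far s\<close> by blast
      then have top: "lev (Suc n) \<gamma> \<in> p"
        using bound p \<gamma>(1) by blast
      obtain k where k: "lev k s \<in> p"
        using \<open>p \<notin> far s\<close> pp unfolding far_def by blast
      have "\<xi> \<sqsubset> \<gamma>"
        using \<gamma>(3) \<open>s \<sqsubset> \<gamma>\<close> by (rule less_trans)
      then obtain m where m: "lev (Suc n) \<gamma> \<inter> underS \<kappa> \<xi> \<subseteq> lev (Suc n + m) \<xi>"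
        using lev_coherent[of \<xi> \<gamma>] by blast
      \<comment> \<open>Ordinals below \<xi> are absorbed by a level of \<xi>; those from \<xi> up
        to \<open>s\<close> have \<open>s\<close> as their first step from \<gamma>, so their level
        drops by one.\<close>
      have "lev k s \<inter> lev (Suc n) \<gamma> \<subseteq> lev n s \<union> lev (Suc n + m) \<xi>"
      proof
        fix \<alpha> assume \<alpha>: "\<alpha> \<in> lev k s \<inter> lev (Suc n) \<gamma>"
        then have "\<alpha> \<sqsubset> s"
          using lev_less by blast
        show "\<alpha> \<in> lev n s \<union> lev (Suc n + m) \<xi>"
        proof (cases "\<alpha> \<sqsubset> \<xi>")
          case True
          then show ?thesis
            using m \<alpha> by blast
        next
          case False
          then have "\<xi> \<sqsubseteq> \<alpha>"
            using less_linear[OF \<xi> less_Field(1)[OF \<open>\<alpha> \<sqsubset> s\<close>]] by blast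
          then have "d \<sqsubset> \<alpha>" if "d \<in> C \<gamma>" "d \<sqsubset> s" for d
            using \<gamma>(2) that less_trans[of d \<xi> \<alpha>] unfolding step_def by blast
          then have "step \<alpha> \<gamma> s"
            using \<gamma>(2) \<open>\<alpha> \<sqsubset> s\<close> unfolding step_def by blast
          then show ?thesis
            using lev_step \<open>\<alpha> \<sqsubset> s\<close> \<alpha> by blast
        qed
      qed
      then have "lev n s \<in> p \<or> lev (Suc n + m) \<xi> \<in> p"
        by (rule points_prime[OF pp k top lev_in_family[OF sF] lev_in_family[OF \<xi>]])
      then show "lev n s \<in> p"
        using p unfolding far_def by blast
    qed
  next
    case False
    then show False
      by (intro no_uniform_jump[OF D]) blast+
  qed
qed

text \<open>If a level \<open>F\<close> of \<delta> lies in \<open>\<sigma> n\<close>, then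
  \<open>point_coherent\<close> puts a level \<open>k + m\<close> of \<gamma>, fixed by
  \<open>F\<close>, into \<open>\<sigma> n\<close>, which fails once \<open>n\<close> reaches
  \<open>k + m\<close>. So every coordinate is eventually absent. Being outside
  \<open>far \<gamma>\<close> supplies the second level that coherence asks for.\<close>

lemma sequence_of_unbounded_level:
  assumes "B \<subseteq> points" "\<gamma> \<in> Field \<kappa>"
    and unb: "\<And>n. \<exists>p\<in>B. p \<notin> far \<gamma> \<and> lev n \<gamma> \<notin> p"
  shows "\<exists>\<sigma> :: nat \<Rightarrow> _. range \<sigma> \<subseteq> B \<and> limitin space \<sigma> {} sequentially"
proof -
  obtain \<sigma> where \<sigma>: "\<And>n. \<sigma> n \<in> B" "\<And>n. \<sigma> n \<notin> far \<gamma>" "\<And>n. lev n \<gamma> \<notin> \<sigma> n"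
    using unb by metis
  then have pts: "\<sigma> n \<in> points" for n
    using assms(1) by blast
  have avoid: "eventually (\<lambda>n. F \<notin> \<sigma> n) sequentially" for F
  proof (cases "F \<in> family")
    case True
    then obtain k \<delta> where F: "F = lev k \<delta>" "\<delta> \<in> Field \<kappa>"
      unfolding family_def by blast
    obtain m where m: "\<forall>p\<in>points. \<forall>n k. lev n \<delta> \<in> p \<longrightarrow> lev k \<gamma> \<in> p \<longrightarrow> lev (n + m) \<gamma> \<in> p"
      using point_coherent[OF assms(2) F(2)] by blast
    have "F \<notin> \<sigma> n" if "k + m \<le> n" for n
    proof
      assume "F \<in> \<sigma> n"
      moreover obtain j where "lev j \<gamma> \<in> \<sigma> n"
        using \<sigma>(2) pts unfolding far_def by blast
      ultimately have "lev (k + m) \<gamma> \<in> \<sigma> n"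
        using m pts F(1) by blast
      then have "lev n \<gamma> \<in> \<sigma> n"
        using point_mono[OF pts \<open>k + m \<le> n\<close>] assms(2) by blast
      then show False
        using \<sigma>(3) by blast
    qed
    then show ?thesis
      unfolding eventually_sequentially by blast
  next
    case False
    then have "F \<notin> \<sigma> n" for n
      using points_subset_family[OF pts] by blast
    then show ?thesis
      by simp
  qed
  have "limitin space \<sigma> {} sequentially"
    unfolding limitin_def
  proof (intro conjI allI impI)
    fix U assume "openin space U \<and> {} \<in> U"
    then obtain \<Phi> where \<Phi>: "finite \<Phi>" "\<forall>q\<in>points. q \<inter> \<Phi> = {} \<longrightarrow> q \<in> U"
      using empty_nhd[of U] by blast
    have "eventually (\<lambda>n. \<forall>F\<in>\<Phi>. F \<notin> \<sigma> n) sequentially"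
      using \<Phi>(1) avoid by (simp add: eventually_ball_finite)
    then show "eventually (\<lambda>n. \<sigma> n \<in> U) sequentially"
    proof (rule eventually_mono)
      fix n assume "\<forall>F\<in>\<Phi>. F \<notin> \<sigma> n"
      then have "\<sigma> n \<inter> \<Phi> = {}"
        by blast
      then show "\<sigma> n \<in> U"
        using \<Phi>(2) pts by blast
    qed
  qed (simp add: empty_in_points)
  then show ?thesis
    using \<sigma>(1) by blast
qed

lemma Frechet_point_space: "Frechet_point space {}"
  unfolding Frechet_point_def
proof (intro conjI allI impI iffI)
  show "{} \<in> topspace space"
    by (simp add: empty_in_points)
next
  fix A :: "'a set set set"
  assume "\<exists>\<sigma> :: nat \<Rightarrow> _. range \<sigma> \<subseteq> A \<and> limitin space \<sigma> {} sequentially"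
  then obtain \<sigma> :: "nat \<Rightarrow> _" where \<sigma>: "range \<sigma> \<subseteq> A" "limitin space \<sigma> {} sequentially"
    by blast
  show "{} \<in> space closure_of A"
    unfolding in_closure_of
  proof (intro conjI allI impI)
    show "{} \<in> topspace space"
      by (simp add: empty_in_points)
    fix U assume "{} \<in> U \<and> openin space U"
    then have "eventually (\<lambda>n. \<sigma> n \<in> U) sequentially"
      using \<sigma>(2) unfolding limitin_def by blast
    then obtain n where "\<sigma> n \<in> U"
      using eventually_happens' sequentially_bot by blast
    then show "\<exists>y. y \<in> A \<and> y \<in> U"
      using \<sigma>(1) by blast
  qed
next
  fix A assume A: "A \<subseteq> topspace space" and cl: "{} \<in> space closure_of A"
  show "\<exists>\<sigma> :: nat \<Rightarrow> _. range \<sigma> \<subseteq> A \<and> limitin space \<sigma> {} sequentially"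
  proof (cases "{} \<in> A")
    case True
    then show ?thesis
      by (intro exI[of _ "\<lambda>_. {}"]) (auto simp: limitin_const_iff empty_in_points)
  next
    case False
    have pts: "A \<subseteq> points"
      using A by simp
    have "\<exists>\<gamma>\<in>Field \<kappa>. \<forall>n. \<exists>p\<in>A. p \<notin> far \<gamma> \<and> lev n \<gamma> \<notin> p"
    proof (rule ccontr)
      assume "\<not> ?thesis"
      then obtain f where f: "\<And>\<gamma> p. \<gamma> \<in> Field \<kappa> \<Longrightarrow> p \<in> A \<Longrightarrow> p \<notin> far \<gamma> \<Longrightarrow> lev (f \<gamma>) \<gamma> \<in> p"
        by metis
      \<comment> \<open>The open set of points omitting \<open>lev (f \<gamma>) \<gamma>\<close>
        contains \<open>{}\<close> and so meets \<open>A\<close>; by the choice of \<open>f\<close>,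
        a common point lies in \<open>far \<gamma>\<close>.\<close>
      have A_far: "A \<inter> far \<gamma> \<noteq> {}" if \<gamma>: "\<gamma> \<in> Field \<kappa>" for \<gamma>
      proof -
        have "{} \<in> {p \<in> points. lev (f \<gamma>) \<gamma> \<notin> p}"
          using empty_in_points by simp
        then have "\<exists>p. p \<in> A \<and> p \<in> {p \<in> points. lev (f \<gamma>) \<gamma> \<notin> p}"
          using conjunct2[OF cl[unfolded in_closure_of]] openin_avoid[of "lev (f \<gamma>) \<gamma>"]
          by (elim allE impE) (rule conjI)
        then show ?thesis
          using f[OF \<gamma>] by blast
      qed
      \<comment> \<open>Pigeonhole: if every fibre of \<open>f\<close> were bounded, an ordinal
        above these countably many bounds would contradict the bound of its own fibre.\<close>
      obtain n where n: "\<And>\<xi>. \<xi> \<in> Field \<kappa> \<Longrightarrow> \<exists>\<gamma>\<in>{\<gamma> \<in> Field \<kappa>. f \<gamma> = n}. \<xi> \<sqsubset> \<gamma>"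
      proof (rule ccontr)
        assume "\<not> thesis"
        then have "\<forall>n. \<exists>\<xi>\<in>Field \<kappa>. \<forall>\<gamma>\<in>Field \<kappa>. f \<gamma> = n \<longrightarrow> \<not> \<xi> \<sqsubset> \<gamma>"
          using that by blast
        then obtain b where b: "\<And>n. b n \<in> Field \<kappa>"
            "\<And>n \<gamma>. \<gamma> \<in> Field \<kappa> \<Longrightarrow> f \<gamma> = n \<Longrightarrow> \<not> b n \<sqsubset> \<gamma>"
          by metis
        have "\<exists>\<gamma>\<in>Field \<kappa>. \<forall>a\<in>range b. a \<sqsubset> \<gamma>"
          by (rule countable_bounded) (use b(1) in auto)
        then obtain \<gamma> where "\<gamma> \<in> Field \<kappa>" "b (f \<gamma>) \<sqsubset> \<gamma>"
          by blast
        then show False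
          using b(2) by blast
      qed
      show False
        by (rule no_uniform_level[OF pts False A_far n, where n = n]) (use f in auto)
    qed
    then show ?thesis
      using sequence_of_unbounded_level[OF pts] by blast
  qed
qed

end

theorem corollary7:
  fixes \<kappa> :: "'a rel"
  assumes "Cinfinite \<kappa>" and "regularCard \<kappa>"
    and "square \<kappa>"
  shows "\<exists>(X :: 'a set set topology) x.
           compact_space X \<and> Hausdorff_space X \<and> Frechet_point X x \<and>
           tightness_at_eq (Gdelta_modification X) x \<kappa>"
proof -
  obtain C where C: "\<forall>a. is_ord_limit \<kappa> a \<longrightarrow> club_in \<kappa> (underS \<kappa> a) (C a)"
      "\<forall>a b. is_ord_succ \<kappa> a b \<longrightarrow> C b = {a}"
      "\<forall>a\<in>Field \<kappa>. \<forall>b. ord_limit_point \<kappa> (C a) b \<longrightarrow> C a \<inter> underS \<kappa> b = C b"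
      "\<nexists>D. club_in \<kappa> (Field \<kappa>) D \<and> (\<forall>a. ord_limit_point \<kappa> D a \<longrightarrow> D \<inter> underS \<kappa> a = C a)"
    using assms(3) unfolding square_def by (elim exE conjE)
  have "square_sequence \<kappa> C"
  proof
    fix D assume "club_in \<kappa> (Field \<kappa>) D"
      and "\<And>a. ord_limit_point \<kappa> D a \<Longrightarrow> D \<inter> underS \<kappa> a = C a"
    then show False
      using C(4) by metis
  qed (simp_all add: assms(1,2) C(1-3))
  then interpret square_sequence \<kappa> C .
  show ?thesis
    using compact_space_space Hausdorff_space_space Frechet_point_space tightness_at_eq_space
    by blast
qed

end
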